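(* Let $q$ be a prime power and $h$ a positive integer. Let $S=\{(x_k,y_k)\}_k\subseteq \mathrm{AG}(2,q)$ be a point set such that $S\cup\{(\infty)\}$ is of affine type $(m_1,m_2,\ldots,m_g)$ in $\mathrm{PG}(2,q)$, with $m_1,\dots,m_g$ pairwise distinct. Let $v_1,\ldots,v_r$ denote integers such that each vertical line of $\mathrm{AG}(2,q)$ is incident with $v_i$ points of $S$ for some $i\in\{1,2,\ldots,r\}$. Take a non-trivial $s$-dimensional $\mathrm{GF}(q)$-subspace $I$ of $\mathrm{GF}(q^h)$ with $I\cap\mathrm{GF}(q)=\{0\}$. Consider the point set $$S'=\{(x_k,y_k+i) : i\in I,\ (x_k,y_k)\in S\}\subseteq \mathrm{AG}(2,q^h)$$ of size $q^s|S|$. Then every vertical line of $\mathrm{AG}(2,q^h)$ meets $S'$ in either $0$ or $q^sv_i$ points for some $i\in\{1,2,\ldots,r\}$. Every non-vertical line of $\mathrm{AG}(2,q^h)$ meets $S'$ in either $0$, or $1$, or $m_i$ points for some $i\in\{1,2,\ldots,g\}$. In particular, $S'\cup\{(\infty)\}$ is of affine type $(0,1,m_1,m_2,\ldots,m_g)$ in $\mathrm{PG}(2,q^h)$, and among the points of $\ell_\infty\setminus\{(\infty)\}$ in $\mathrm{PG}(2,q^h)$ there are: (1) $q^{s+1}$ directions $(d)$ such that the $q^h$ affine lines incident with $(d)$ are partitioned into $q^h-q^{s+1}$ lines that do not meet $S'$ and, for each $i\in\{1,\dots,g\}$, $A_{i,d}\,q^s$ lines each meeting $S'$ in $m_i$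 points. These are exactly the directions $(d)$ with $d\in\mathrm{GF}(q)\oplus I$; for each such $d$ write $d=d_0+d_1$ with $d_0\in\mathrm{GF}(q)$ and $d_1\in I$. Then, for $i\in\{1,2,\ldots,g\}$, $A_{i,d}$ is the number of affine $m_i$-secants of $S$ in $\mathrm{PG}(2,q)$ incident with the direction $(d_0)\neq(\infty)$, and $\sum_{i=1}^g A_{i,d}=q$; (2) $q^h-q^{s+1}$ directions each incident with $q^s|S|$ tangents to $S'$ (affine lines meeting $S'$ in exactly one point) and with $q^h-q^s|S|$ affine lines that do not meet $S'$.
   Context: For a prime power $Q$, $\mathrm{AG}(2,Q)$ is $\mathrm{PG}(2,Q)$ minus the line at infinity $\ell_\infty$; affine points are written $(x,y)$. Vertical lines are the affine lines of equation $x=\alpha$; $(\infty)\in\ell_\infty$ is their common ideal point. For $d\in\mathrm{GF}(Q)$, $(d)\in\ell_\infty$ (a "direction") is the common ideal point of the lines $y=dx+b$. A line is a $k$-secant of a point set if it meets it in exactly $k$ points. A point set $X$ of $\mathrm{PG}(2,Q)$ with $X\cap\ell_\infty=\{(\infty)\}$ is of affine type $(n_1,\ldots,n_k)$ (with distinguished point $(\infty)$ and tangent $\ell_\infty$) if for each line $\ell\not\ni(\infty)$ we have $|X\cap\ell|=n_i$ for some $i\in\{1,\ldots,k\}$. (It is not required that each $n_i$ occurs.) *)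

theory Defs
  imports
    "HOL-Algebra.Embedded_Algebras"
    "HOL-Number_Theory.Prime_Powers"
    "HOL-Library.Disjoint_Sets"
begin

text \<open>
  The plane PG(2,F) over a field F (a ring record), in homogeneous coordinates: the points are the
  classes of nonzero triples modulo nonzero scalars, and a line is the set of the points it contains.
  The line at infinity is z = 0.
\<close>

definition nonzero_triples :: "('a, 'b) ring_scheme \<Rightarrow> ('a \<times> 'a \<times> 'a) set" where
  "nonzero_triples F =
     carrier F \<times> carrier F \<times> carrier F - {(\<zero>\<^bsub>F\<^esub>, \<zero>\<^bsub>F\<^esub>, \<zero>\<^bsub>F\<^esub>)}"

definition pg_point :: "('a, 'b) ring_scheme \<Rightarrow> 'a \<times> 'a \<times> 'a \<Rightarrow> ('a \<times> 'a \<times> 'a) set" where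
  "pg_point F = (\<lambda>(x, y, z).
     {(c \<otimes>\<^bsub>F\<^esub> x, c \<otimes>\<^bsub>F\<^esub> y, c \<otimes>\<^bsub>F\<^esub> z) | c. c \<in> carrier F - {\<zero>\<^bsub>F\<^esub>}})"

definition pg_points :: "('a, 'b) ring_scheme \<Rightarrow> ('a \<times> 'a \<times> 'a) set set" where
  "pg_points F = pg_point F ` nonzero_triples F"

definition pg_line :: "('a, 'b) ring_scheme \<Rightarrow> 'a \<times> 'a \<times> 'a \<Rightarrow> ('a \<times> 'a \<times> 'a) set set" where
  "pg_line F = (\<lambda>(a, b, c).
     {pg_point F (x, y, z) | x y z. (x, y, z) \<in> nonzero_triples F \<and>
        a \<otimes>\<^bsub>F\<^esub> x \<oplus>\<^bsub>F\<^esub> b \<otimes>\<^bsub>F\<^esub> y \<oplus>\<^bsub>F\<^esub> c \<otimes>\<^bsub>F\<^esub> z = \<zero>\<^bsub>F\<^esub>})"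

definition pg_lines :: "('a, 'b) ring_scheme \<Rightarrow> ('a \<times> 'a \<times> 'a) set set set" where
  "pg_lines F = pg_line F ` nonzero_triples F"

definition line_inf :: "('a, 'b) ring_scheme \<Rightarrow> ('a \<times> 'a \<times> 'a) set set" where
  "line_inf F = pg_line F (\<zero>\<^bsub>F\<^esub>, \<zero>\<^bsub>F\<^esub>, \<one>\<^bsub>F\<^esub>)"

definition aff_point :: "('a, 'b) ring_scheme \<Rightarrow> 'a \<times> 'a \<Rightarrow> ('a \<times> 'a \<times> 'a) set" where
  "aff_point F = (\<lambda>(x, y). pg_point F (x, y, \<one>\<^bsub>F\<^esub>))"

definition direction :: "('a, 'b) ring_scheme \<Rightarrow> 'a \<Rightarrow> ('a \<times> 'a \<times> 'a) set" where
  "direction F d = pg_point F (\<one>\<^bsub>F\<^esub>, d, \<zero>\<^bsub>F\<^esub>)"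

definition pt_inf :: "('a, 'b) ring_scheme \<Rightarrow> ('a \<times> 'a \<times> 'a) set" where
  "pt_inf F = pg_point F (\<zero>\<^bsub>F\<^esub>, \<one>\<^bsub>F\<^esub>, \<zero>\<^bsub>F\<^esub>)"

text \<open>An affine line is represented by its projective completion, so it contains its ideal point.\<close>

definition affine_lines :: "('a, 'b) ring_scheme \<Rightarrow> ('a \<times> 'a \<times> 'a) set set set" where
  "affine_lines F = pg_lines F - {line_inf F}"

definition vertical_lines :: "('a, 'b) ring_scheme \<Rightarrow> ('a \<times> 'a \<times> 'a) set set set" where
  "vertical_lines F = {pg_line F (\<one>\<^bsub>F\<^esub>, \<zero>\<^bsub>F\<^esub>, \<ominus>\<^bsub>F\<^esub> \<alpha>) | \<alpha>. \<alpha> \<in> carrier F}"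

definition affine_secants_through ::
  "('a, 'b) ring_scheme \<Rightarrow> ('a \<times> 'a \<times> 'a) set set \<Rightarrow> nat \<Rightarrow> ('a \<times> 'a \<times> 'a) set
    \<Rightarrow> ('a \<times> 'a \<times> 'a) set set set" where
  "affine_secants_through F X k P = {l \<in> affine_lines F. P \<in> l \<and> card (l \<inter> X) = k}"

definition affine_type ::
  "('a, 'b) ring_scheme \<Rightarrow> ('a \<times> 'a \<times> 'a) set set \<Rightarrow> nat list \<Rightarrow> bool" where
  "affine_type F X ns \<longleftrightarrow>
     X \<subseteq> pg_points F \<and> X \<inter> line_inf F = {pt_inf F} \<and>
     (\<forall>l \<in> pg_lines F. pt_inf F \<notin> l \<longrightarrow> (\<exists>i < length ns. card (l \<inter> X) = ns ! i))"

end

theory Submission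
  imports Defs
begin

text \<open>
  Write \<open>V = K + I\<close>. Since \<open>I\<close> meets \<open>K\<close> only in zero, this sum is direct, and \<open>V\<close> has \<open>q ^ (s + 1)\<close>
  elements (\<open>card_subspace\<close>, \<open>card_direct_sum\<close>). The points of \<open>S'\<close> have their abscissa in \<open>K\<close> and
  their ordinate in \<open>V\<close>, and how a line \<open>y = d x + b\<close> meets \<open>S'\<close> is governed by whether \<open>d\<close> and \<open>b\<close>
  lie in \<open>V\<close>. In the locale below, \<open>S'\<close> is called \<open>T\<close>.

  If \<open>d = d\<^sub>0 + d\<^sub>1\<close> and \<open>b = b\<^sub>0 + b\<^sub>1\<close> are in \<open>V\<close>, then comparing components in \<open>K\<close> and in \<open>I\<close> splits
  the equation \<open>y + i = d x + b\<close> into \<open>y = d\<^sub>0 x + b\<^sub>0\<close> and \<open>i = d\<^sub>1 x + b\<^sub>1\<close>. The second equation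
  determines \<open>i\<close>, so the line meets \<open>S'\<close> in as many points as \<open>y = d\<^sub>0 x + b\<^sub>0\<close> meets \<open>S\<close>
  (\<open>card_points_on_slope_V\<close>). If \<open>d\<close> is in \<open>V\<close> and \<open>b\<close> is not, the line misses \<open>S'\<close>, because \<open>V\<close>
  is closed under multiplication by \<open>x\<close> in \<open>K\<close> (\<open>points_on_slope_outside_V\<close>). For a direction in \<open>V\<close>,
  sorting the lines by \<open>b\<close> gives the first list of secants (\<open>secants_of_direction_in_V\<close>).

  If \<open>d\<close> is not in \<open>V\<close>, no line of slope \<open>d\<close> contains two points of \<open>S'\<close>: their difference quotient
  would be an element of \<open>V\<close> equal to \<open>d\<close>, since the denominator is in the field \<open>K\<close>
  (\<open>inj_on_intercept\<close>). So the lines of that slope that meet \<open>S'\<close> are tangents, one through each point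
  (\<open>secants_of_direction_outside_V\<close>).

  On a vertical line \<open>x = \<alpha>\<close> with \<open>\<alpha>\<close> in \<open>K\<close>, each point of \<open>S\<close> has \<open>q ^ s\<close> translates, and all of
  these are different; there are no points over other \<open>\<alpha>\<close> (\<open>card_vertical_fibre\<close>).
\<close>

section \<open>Lines and points of the projective plane in affine coordinates\<close>

text \<open>The line \<open>y = d x + b\<close>, whose ideal point is \<open>(d)\<close>.\<close>

definition slope_line :: "('a, 'b) ring_scheme \<Rightarrow> 'a \<Rightarrow> 'a \<Rightarrow> ('a \<times> 'a \<times> 'a) set set" where
  "slope_line R d b = pg_line R (d, \<ominus>\<^bsub>R\<^esub> \<one>\<^bsub>R\<^esub>, b)"

definition vertical_line :: "('a, 'b) ring_scheme \<Rightarrow> 'a \<Rightarrow> ('a \<times> 'a \<times> 'a) set set" where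
  "vertical_line R \<alpha> = pg_line R (\<one>\<^bsub>R\<^esub>, \<zero>\<^bsub>R\<^esub>, \<ominus>\<^bsub>R\<^esub> \<alpha>)"

definition points_on_slope ::
  "('a, 'b) ring_scheme \<Rightarrow> ('a \<times> 'a) set \<Rightarrow> 'a \<Rightarrow> 'a \<Rightarrow> ('a \<times> 'a) set" where
  "points_on_slope R S d b = {(x, y) \<in> S. y = d \<otimes>\<^bsub>R\<^esub> x \<oplus>\<^bsub>R\<^esub> b}"

context field
begin

lemma nonzero_triples_iff:
  "(x, y, z) \<in> nonzero_triples R \<longleftrightarrow>
     x \<in> carrier R \<and> y \<in> carrier R \<and> z \<in> carrier R \<and> \<not> (x = \<zero> \<and> y = \<zero> \<and> z = \<zero>)"
  by (auto simp: nonzero_triples_def)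

lemma mem_pg_point:
  "p \<in> pg_point R (x, y, z) \<longleftrightarrow>
     (\<exists>c \<in> carrier R. c \<noteq> \<zero> \<and> p = (c \<otimes> x, c \<otimes> y, c \<otimes> z))"
  by (auto simp: pg_point_def)

lemma self_in_pg_point:
  assumes "x \<in> carrier R" "y \<in> carrier R" "z \<in> carrier R"
  shows "(x, y, z) \<in> pg_point R (x, y, z)"
  unfolding mem_pg_point using assms by (intro bexI[of _ \<one>]) auto

lemma pg_point_eqD:
  assumes "pg_point R (x, y, z) = pg_point R (x', y', z')"
    and "x \<in> carrier R" "y \<in> carrier R" "z \<in> carrier R"
  obtains c where "c \<in> carrier R" "c \<noteq> \<zero>" "x = c \<otimes> x'" "y = c \<otimes> y'" "z = c \<otimes> z'"
  using self_in_pg_point[OF assms(2-4)] unfolding assms(1) mem_pg_point by auto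

lemma inv_nonzero:
  assumes "u \<in> carrier R" "u \<noteq> \<zero>"
  shows "inv u \<in> carrier R" "inv u \<otimes> u = \<one>" "inv u \<noteq> \<zero>"
proof -
  have "u \<in> Units R" using assms by (simp add: field_Units)
  then show "inv u \<in> carrier R" "inv u \<otimes> u = \<one>" by auto
  then show "inv u \<noteq> \<zero>" using assms(1) one_not_zero by auto
qed

lemma pg_point_scale:
  assumes u: "u \<in> carrier R" "u \<noteq> \<zero>"
    and abc: "a \<in> carrier R" "b \<in> carrier R" "c \<in> carrier R"
  shows "pg_point R (u \<otimes> a, u \<otimes> b, u \<otimes> c) = pg_point R (a, b, c)"
proof (intro equalityI subsetI)
  fix t assume "t \<in> pg_point R (u \<otimes> a, u \<otimes> b, u \<otimes> c)"
  then obtain k where "k \<in> carrier R" "k \<noteq> \<zero>" "t = (k \<otimes> (u \<otimes> a), k \<otimes> (u \<otimes> b), k \<otimes> (u \<otimes> c))"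
    unfolding mem_pg_point by blast
  then show "t \<in> pg_point R (a, b, c)"
    unfolding mem_pg_point using u abc
    by (intro bexI[of _ "k \<otimes> u"]) (auto simp: m_assoc integral_iff)
next
  fix t assume "t \<in> pg_point R (a, b, c)"
  then obtain k where k: "k \<in> carrier R" "k \<noteq> \<zero>" "t = (k \<otimes> a, k \<otimes> b, k \<otimes> c)"
    unfolding mem_pg_point by blast
  note i = inv_nonzero[OF u]
  have "k \<otimes> inv u \<otimes> (u \<otimes> w) = k \<otimes> w" if "w \<in> carrier R" for w
  proof -
    have "k \<otimes> inv u \<otimes> (u \<otimes> w) = k \<otimes> (inv u \<otimes> u) \<otimes> w"
      using that i(1) u k(1) by (simp add: m_assoc)
    then show ?thesis using i k that by simp
  qed
  then show "t \<in> pg_point R (u \<otimes> a, u \<otimes> b, u \<otimes> c)"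
    unfolding mem_pg_point using u abc k i
    by (intro bexI[of _ "k \<otimes> inv u"]) (auto simp: integral_iff)
qed

text \<open>
  A linear form is homogeneous, so whether it vanishes at a triple depends only on the projective
  point of that triple. Hence incidence can be tested on any representative.
\<close>

lemma pg_point_in_pg_line:
  assumes "(x, y, z) \<in> nonzero_triples R" "a \<in> carrier R" "b \<in> carrier R" "c \<in> carrier R"
  shows "pg_point R (x, y, z) \<in> pg_line R (a, b, c) \<longleftrightarrow> a \<otimes> x \<oplus> b \<otimes> y \<oplus> c \<otimes> z = \<zero>"
proof
  have xyz: "x \<in> carrier R" "y \<in> carrier R" "z \<in> carrier R"
    using assms(1) by (auto simp: nonzero_triples_iff)
  assume "pg_point R (x, y, z) \<in> pg_line R (a, b, c)"
  then obtain x' y' z' where *: "pg_point R (x, y, z) = pg_point R (x', y', z')"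
    "(x', y', z') \<in> nonzero_triples R" "a \<otimes> x' \<oplus> b \<otimes> y' \<oplus> c \<otimes> z' = \<zero>"
    by (auto simp: pg_line_def)
  have xyz': "x' \<in> carrier R" "y' \<in> carrier R" "z' \<in> carrier R"
    using *(2) by (auto simp: nonzero_triples_iff)
  obtain e where e: "e \<in> carrier R" "x = e \<otimes> x'" "y = e \<otimes> y'" "z = e \<otimes> z'"
    using pg_point_eqD[OF *(1) xyz] by metis
  have "a \<otimes> x \<oplus> b \<otimes> y \<oplus> c \<otimes> z = e \<otimes> (a \<otimes> x' \<oplus> b \<otimes> y' \<oplus> c \<otimes> z')"
    unfolding e(2-4) using e(1) xyz' assms(2-4) by algebra
  then show "a \<otimes> x \<oplus> b \<otimes> y \<oplus> c \<otimes> z = \<zero>"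
    using *(3) e(1) by simp
next
  assume "a \<otimes> x \<oplus> b \<otimes> y \<oplus> c \<otimes> z = \<zero>"
  then show "pg_point R (x, y, z) \<in> pg_line R (a, b, c)"
    using assms(1) unfolding pg_line_def by auto
qed

lemma pg_line_scale:
  assumes "e \<in> carrier R" "e \<noteq> \<zero>" "a \<in> carrier R" "b \<in> carrier R" "c \<in> carrier R"
  shows "pg_line R (e \<otimes> a, e \<otimes> b, e \<otimes> c) = pg_line R (a, b, c)"
proof -
  have "e \<otimes> a \<otimes> x \<oplus> e \<otimes> b \<otimes> y \<oplus> e \<otimes> c \<otimes> z = \<zero> \<longleftrightarrow> a \<otimes> x \<oplus> b \<otimes> y \<oplus> c \<otimes> z = \<zero>"
    if "(x, y, z) \<in> nonzero_triples R" for x y z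
  proof -
    have xyz: "x \<in> carrier R" "y \<in> carrier R" "z \<in> carrier R"
      using that by (auto simp: nonzero_triples_iff)
    have "e \<otimes> a \<otimes> x \<oplus> e \<otimes> b \<otimes> y \<oplus> e \<otimes> c \<otimes> z = e \<otimes> (a \<otimes> x \<oplus> b \<otimes> y \<oplus> c \<otimes> z)"
      using xyz assms by algebra
    then show ?thesis
      using xyz assms by (simp add: integral_iff)
  qed
  then show ?thesis
    unfolding pg_line_def prod.case by (metis (no_types, lifting))
qed

lemma solve_slope_equation:
  assumes "d \<in> carrier R" "b \<in> carrier R" "x \<in> carrier R" "y \<in> carrier R"
  shows "d \<otimes> x \<oplus> \<ominus> \<one> \<otimes> y \<oplus> b = \<zero> \<longleftrightarrow> y = d \<otimes> x \<oplus> b"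
proof -
  have "d \<otimes> x \<oplus> \<ominus> \<one> \<otimes> y \<oplus> b = (d \<otimes> x \<oplus> b) \<ominus> y"
    using assms by algebra
  then show ?thesis
    using assms by (metis r_right_minus_eq a_closed m_closed)
qed

lemma triple_one_nonzero:
  assumes "a \<in> carrier R" "b \<in> carrier R"
  shows "(a, b, \<one>) \<in> nonzero_triples R" "(a, \<one>, b) \<in> nonzero_triples R"
    "(\<one>, a, b) \<in> nonzero_triples R" "(a, \<ominus> \<one>, b) \<in> nonzero_triples R"
  using assms one_not_zero by (auto simp: nonzero_triples_iff)

lemma aff_point_in_slope_line:
  assumes "d \<in> carrier R" "b \<in> carrier R" "x \<in> carrier R" "y \<in> carrier R"
  shows "aff_point R (x, y) \<in> slope_line R d b \<longleftrightarrow> y = d \<otimes> x \<oplus> b"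
  using assms by (simp add: aff_point_def slope_line_def pg_point_in_pg_line triple_one_nonzero
      solve_slope_equation)

lemma direction_in_slope_line:
  assumes "d \<in> carrier R" "b \<in> carrier R" "e \<in> carrier R"
  shows "direction R e \<in> slope_line R d b \<longleftrightarrow> e = d"
  using assms solve_slope_equation[of d \<zero> \<one> e]
  by (simp add: direction_def slope_line_def pg_point_in_pg_line triple_one_nonzero)

lemma pt_inf_notin_slope_line:
  assumes "d \<in> carrier R" "b \<in> carrier R"
  shows "pt_inf R \<notin> slope_line R d b"
  using assms by (simp add: pt_inf_def slope_line_def pg_point_in_pg_line triple_one_nonzero)

lemma aff_point_in_vertical_line:
  assumes "\<alpha> \<in> carrier R" "x \<in> carrier R" "y \<in> carrier R"
  shows "aff_point R (x, y) \<in> vertical_line R \<alpha> \<longleftrightarrow> x = \<alpha>"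
  using assms r_right_minus_eq[of x \<alpha>]
  by (simp add: aff_point_def vertical_line_def pg_point_in_pg_line triple_one_nonzero a_minus_def)

lemma direction_notin_vertical_line:
  assumes "\<alpha> \<in> carrier R" "d \<in> carrier R"
  shows "direction R d \<notin> vertical_line R \<alpha>"
  using assms
  by (simp add: direction_def vertical_line_def pg_point_in_pg_line triple_one_nonzero)

lemma pt_inf_in_vertical_line:
  assumes "\<alpha> \<in> carrier R"
  shows "pt_inf R \<in> vertical_line R \<alpha>"
  using assms
  by (simp add: pt_inf_def vertical_line_def pg_point_in_pg_line triple_one_nonzero)

lemma ideal_points_in_line_inf:
  shows "x \<in> carrier R \<Longrightarrow> y \<in> carrier R \<Longrightarrow> aff_point R (x, y) \<notin> line_inf R"
    and "d \<in> carrier R \<Longrightarrow> direction R d \<in> line_inf R"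
    and "pt_inf R \<in> line_inf R"
  by (simp_all add: aff_point_def direction_def pt_inf_def line_inf_def pg_point_in_pg_line
      triple_one_nonzero)

lemma inj_on_aff_point: "inj_on (aff_point R) (carrier R \<times> carrier R)"
proof (rule inj_onI, clarify)
  fix x y x' y'
  assume car: "x \<in> carrier R" "y \<in> carrier R" "x' \<in> carrier R" "y' \<in> carrier R"
    and eq: "aff_point R (x, y) = aff_point R (x', y')"
  obtain c where "c \<in> carrier R" "x = c \<otimes> x'" "y = c \<otimes> y'" "\<one> = c \<otimes> \<one>"
    using pg_point_eqD[of x y \<one> x' y' \<one>] eq car by (auto simp: aff_point_def)
  then show "x = x' \<and> y = y'" using car by auto
qed

lemma inj_on_direction: "inj_on (direction R) (carrier R)"
proof (rule inj_onI)
  fix d d'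
  assume car: "d \<in> carrier R" "d' \<in> carrier R" and eq: "direction R d = direction R d'"
  obtain c where "c \<in> carrier R" "d = c \<otimes> d'" "\<one> = c \<otimes> \<one>"
    using pg_point_eqD[of \<one> d \<zero> \<one> d' \<zero>] eq car by (auto simp: direction_def)
  then show "d = d'" using car by auto
qed

lemma direction_neq_pt_inf:
  assumes "d \<in> carrier R"
  shows "direction R d \<noteq> pt_inf R"
  using assms direction_notin_vertical_line[of \<zero> d] pt_inf_in_vertical_line[of \<zero>] by auto

lemma slope_line_inj:
  assumes "d \<in> carrier R" "b \<in> carrier R" "d' \<in> carrier R" "b' \<in> carrier R"
    and "slope_line R d b = slope_line R d' b'"
  shows "d = d' \<and> b = b'"
proof
  show "d = d'"
    using direction_in_slope_line[of d b d] direction_in_slope_line[of d' b' d] assms by simp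
  \<comment> \<open>the intercept is read off at the point with abscissa zero\<close>
  show "b = b'"
    using aff_point_in_slope_line[of d b \<zero> b] aff_point_in_slope_line[of d' b' \<zero> b] assms by simp
qed

text \<open>
  Scaling normalises the coefficient triple \<open>(a, b, c)\<close> of a line: to \<open>b = - 1\<close> if \<open>b \<noteq> 0\<close>, otherwise to
  \<open>a = 1\<close> if \<open>a \<noteq> 0\<close>, and otherwise to \<open>(0, 0, 1)\<close>. All later counts of lines are therefore counts of
  intercepts.
\<close>

lemma pg_lines_eq:
  "pg_lines R = {slope_line R d b | d b. d \<in> carrier R \<and> b \<in> carrier R}
     \<union> vertical_line R ` carrier R \<union> {line_inf R}" (is "_ = ?rhs")
proof (intro equalityI subsetI)
  fix l assume "l \<in> pg_lines R"
  then obtain a b c where abc: "(a, b, c) \<in> nonzero_triples R" and l: "l = pg_line R (a, b, c)"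
    by (auto simp: pg_lines_def)
  have car: "a \<in> carrier R" "b \<in> carrier R" "c \<in> carrier R"
    using abc by (auto simp: nonzero_triples_iff)
  consider "b \<noteq> \<zero>" | "b = \<zero>" "a \<noteq> \<zero>" | "b = \<zero>" "a = \<zero>" "c \<noteq> \<zero>"
    using abc by (auto simp: nonzero_triples_iff)
  then show "l \<in> ?rhs"
  proof cases
    case 1
    let ?e = "\<ominus> (inv b)"
    have e: "?e \<in> carrier R" "?e \<noteq> \<zero>" "?e \<otimes> b = \<ominus> \<one>"
      using inv_nonzero[of b] 1 car by (auto simp: l_minus)
    have "l = slope_line R (?e \<otimes> a) (?e \<otimes> c)"
      using pg_line_scale[OF e(1,2) car] e(3) l by (simp add: slope_line_def)
    then show ?thesis using e(1) car by blast
  next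
    case 2
    let ?e = "inv a"
    have e: "?e \<in> carrier R" "?e \<noteq> \<zero>" "?e \<otimes> a = \<one>"
      using inv_nonzero[of a] 2 car by auto
    have "l = vertical_line R (\<ominus> (?e \<otimes> c))"
      using pg_line_scale[OF e(1,2) car] e 2 car l by (simp add: vertical_line_def)
    then show ?thesis using e(1) car by blast
  next
    case 3
    let ?e = "inv c"
    have e: "?e \<in> carrier R" "?e \<noteq> \<zero>" "?e \<otimes> c = \<one>"
      using inv_nonzero[of c] 3 car by auto
    have "l = line_inf R"
      using pg_line_scale[OF e(1,2) car] e 3 car l by (simp add: line_inf_def)
    then show ?thesis by blast
  qed
next
  fix l assume "l \<in> ?rhs"
  then show "l \<in> pg_lines R"
    unfolding pg_lines_def slope_line_def vertical_line_def line_inf_def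
    by (auto intro!: imageI triple_one_nonzero)
qed

lemma vertical_lines_eq: "vertical_lines R = vertical_line R ` carrier R"
  by (auto simp: vertical_lines_def vertical_line_def)

lemma affine_lines_eq:
  "affine_lines R = {slope_line R d b | d b. d \<in> carrier R \<and> b \<in> carrier R} \<union> vertical_lines R"
proof -
  have "slope_line R d b \<noteq> line_inf R" if "d \<in> carrier R" "b \<in> carrier R" for d b
    using pt_inf_notin_slope_line[OF that] ideal_points_in_line_inf(3) by metis
  moreover have "vertical_line R \<alpha> \<noteq> line_inf R" if "\<alpha> \<in> carrier R" for \<alpha>
    using direction_notin_vertical_line[OF that zero_closed] ideal_points_in_line_inf(2) by auto
  ultimately show ?thesis
    unfolding affine_lines_def pg_lines_eq vertical_lines_eq by blast
qed

lemma affine_lines_through_direction: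
  assumes "d \<in> carrier R"
  shows "{l \<in> affine_lines R. direction R d \<in> l} = slope_line R d ` carrier R"
  using assms direction_notin_vertical_line direction_in_slope_line
  unfolding affine_lines_eq vertical_lines_eq by auto

lemma inj_on_slope_line: "d \<in> carrier R \<Longrightarrow> inj_on (slope_line R d) (carrier R)"
  using slope_line_inj by (intro inj_onI) metis

lemma line_inf_eq: "line_inf R - {pt_inf R} = direction R ` carrier R"
proof (intro equalityI subsetI)
  fix p assume p: "p \<in> line_inf R - {pt_inf R}"
  then obtain x y z where xyz: "(x, y, z) \<in> nonzero_triples R" and pe: "p = pg_point R (x, y, z)"
    by (auto simp: line_inf_def pg_line_def)
  have car: "x \<in> carrier R" "y \<in> carrier R" "z \<in> carrier R"
    using xyz by (auto simp: nonzero_triples_iff)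
  have z: "z = \<zero>"
    using p xyz car unfolding pe line_inf_def by (simp add: pg_point_in_pg_line)
  have x: "x \<noteq> \<zero>"
  proof
    assume "x = \<zero>"
    then have "y \<noteq> \<zero>" using z xyz by (auto simp: nonzero_triples_iff)
    then have "p = pt_inf R"
      using pg_point_scale[of y \<zero> \<one> \<zero>] car pe z \<open>x = \<zero>\<close> by (simp add: pt_inf_def)
    then show False using p by simp
  qed
  have i: "inv x \<in> carrier R" "x \<otimes> inv x = \<one>"
    using inv_nonzero[of x] x car by (auto simp: m_comm)
  have "p = direction R (inv x \<otimes> y)"
    using pg_point_scale[of x \<one> "inv x \<otimes> y" \<zero>] x car i z pe
    by (simp add: direction_def m_assoc[symmetric])
  then show "p \<in> direction R ` carrier R" using i car by blast
next
  fix p assume "p \<in> direction R ` carrier R"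
  then show "p \<in> line_inf R - {pt_inf R}"
    using ideal_points_in_line_inf direction_neq_pt_inf by auto
qed

lemma card_Int_aff_points:
  assumes "S \<subseteq> carrier R \<times> carrier R"
  shows "card (l \<inter> aff_point R ` S) = card {p \<in> S. aff_point R p \<in> l}"
proof -
  have "l \<inter> aff_point R ` S = aff_point R ` {p \<in> S. aff_point R p \<in> l}"
    by blast
  moreover have "inj_on (aff_point R) {p \<in> S. aff_point R p \<in> l}"
    using assms by (intro inj_on_subset[OF inj_on_aff_point]) blast
  ultimately show ?thesis by (simp add: card_image)
qed

lemma card_slope_line_Int:
  assumes "d \<in> carrier R" "b \<in> carrier R" "S \<subseteq> carrier R \<times> carrier R"
  shows "card (slope_line R d b \<inter> aff_point R ` S) = card (points_on_slope R S d b)"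
proof -
  have "{p \<in> S. aff_point R p \<in> slope_line R d b} = points_on_slope R S d b"
    unfolding points_on_slope_def
    using assms(3) aff_point_in_slope_line[OF assms(1,2)] by (intro Collect_cong) auto
  then show ?thesis by (simp add: card_Int_aff_points[OF assms(3)])
qed

lemma card_vertical_line_Int:
  assumes "\<alpha> \<in> carrier R" "S \<subseteq> carrier R \<times> carrier R"
  shows "card (vertical_line R \<alpha> \<inter> aff_point R ` S) = card {p \<in> S. fst p = \<alpha>}"
proof -
  have "{p \<in> S. aff_point R p \<in> vertical_line R \<alpha>} = {p \<in> S. fst p = \<alpha>}"
    using assms(2) aff_point_in_vertical_line[OF assms(1)] by (intro Collect_cong) auto
  then show ?thesis by (simp add: card_Int_aff_points[OF assms(2)])
qed

text \<open>
  The right-hand side speaks of the equation \<open>y = d x + b\<close> alone, which uses only addition and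
  multiplication and so reads the same in a field and in a subfield. This is what links the secants of
  a point set in the small plane to those of its translates in the large one.
\<close>

lemma affine_secants_through_direction:
  assumes "d \<in> carrier R" "S \<subseteq> carrier R \<times> carrier R"
  shows "affine_secants_through R (aff_point R ` S) k (direction R d) =
    slope_line R d ` {b \<in> carrier R. card (points_on_slope R S d b) = k}"
proof -
  have "affine_secants_through R (aff_point R ` S) k (direction R d) =
    {l \<in> {l \<in> affine_lines R. direction R d \<in> l}. card (l \<inter> aff_point R ` S) = k}"
    unfolding affine_secants_through_def by auto
  then show ?thesis
    unfolding affine_lines_through_direction[OF assms(1)]
    using card_slope_line_Int[OF assms(1) _ assms(2)] by auto
qed

lemma card_affine_secants_through_direction:
  assumes "d \<in> carrier R" "S \<subseteq> carrier R \<times> carrier R"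
  shows "card (affine_secants_through R (aff_point R ` S) k (direction R d)) =
    card {b \<in> carrier R. card (points_on_slope R S d b) = k}"
  unfolding affine_secants_through_direction[OF assms]
  by (intro card_image inj_on_subset[OF inj_on_slope_line[OF assms(1)]]) auto

lemma affine_type_iff:
  assumes "S \<subseteq> carrier R \<times> carrier R"
  shows "affine_type R (aff_point R ` S \<union> {pt_inf R}) ns \<longleftrightarrow>
    (\<forall>d \<in> carrier R. \<forall>b \<in> carrier R. \<exists>i < length ns. card (points_on_slope R S d b) = ns ! i)"
proof -
  let ?X = "aff_point R ` S \<union> {pt_inf R}"
  have pts: "?X \<subseteq> pg_points R"
    using assms triple_one_nonzero
    by (auto simp: pg_points_def aff_point_def pt_inf_def intro!: imageI)
  have inf: "?X \<inter> line_inf R = {pt_inf R}"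
    using assms ideal_points_in_line_inf by auto
  have lines: "{l \<in> pg_lines R. pt_inf R \<notin> l} =
      {slope_line R d b | d b. d \<in> carrier R \<and> b \<in> carrier R}"
    using ideal_points_in_line_inf(3) pt_inf_in_vertical_line pt_inf_notin_slope_line
    unfolding pg_lines_eq by blast
  have card: "card (slope_line R d b \<inter> ?X) = card (points_on_slope R S d b)"
    if "d \<in> carrier R" "b \<in> carrier R" for d b
  proof -
    have "slope_line R d b \<inter> ?X = slope_line R d b \<inter> aff_point R ` S"
      using pt_inf_notin_slope_line[OF that] by auto
    then show ?thesis using card_slope_line_Int[OF that assms] by simp
  qed
  have "affine_type R ?X ns \<longleftrightarrow>
      (\<forall>l \<in> {l \<in> pg_lines R. pt_inf R \<notin> l}. \<exists>i < length ns. card (l \<inter> ?X) = ns ! i)"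
    unfolding affine_type_def using pts inf by (simp, blast)
  also have "\<dots> \<longleftrightarrow> (\<forall>d \<in> carrier R. \<forall>b \<in> carrier R.
      \<exists>i < length ns. card (slope_line R d b \<inter> ?X) = ns ! i)"
    unfolding lines by blast
  also have "\<dots> \<longleftrightarrow> (\<forall>d \<in> carrier R. \<forall>b \<in> carrier R.
      \<exists>i < length ns. card (points_on_slope R S d b) = ns ! i)"
    using card by simp
  finally show ?thesis .
qed

end

section \<open>Direct sums and the cardinality of a subspace\<close>

text \<open>Moving terms across \<open>a + b = a' + b'\<close> gives \<open>a - a' = b' - b\<close>, an element of both subgroups.\<close>

lemma (in ring) direct_sum_unique:
  assumes "subgroup A (add_monoid R)" "subgroup B (add_monoid R)" "A \<inter> B = {\<zero>}"
    and "a \<in> A" "a' \<in> A" "b \<in> B" "b' \<in> B" "a \<oplus> b = a' \<oplus> b'"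
  shows "a = a' \<and> b = b'"
proof -
  have car: "a \<in> carrier R" "a' \<in> carrier R" "b \<in> carrier R" "b' \<in> carrier R"
    using assms add.subgroupE(1) by blast+
  have "a \<ominus> a' = a \<oplus> b \<ominus> b \<ominus> a'" using car by algebra
  also have "\<dots> = a' \<oplus> b' \<ominus> b \<ominus> a'" using assms(8) by simp
  also have "\<dots> = b' \<ominus> b" using car by algebra
  finally have eq: "a \<ominus> a' = b' \<ominus> b" .
  have "a \<ominus> a' \<in> A" "b' \<ominus> b \<in> B"
    using assms(1,2,4-7) add.subgroupE(3,4) by (simp_all add: a_minus_def)
  then have "a \<ominus> a' = \<zero>" "b' \<ominus> b = \<zero>"
    using assms(3) eq by auto
  then show ?thesis using car by simp
qed

lemma (in ring) inj_on_direct_sum: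
  assumes "subgroup A (add_monoid R)" "subgroup B (add_monoid R)" "A \<inter> B = {\<zero>}"
  shows "inj_on (\<lambda>(a, b). a \<oplus> b) (A \<times> B)"
  using direct_sum_unique[OF assms] by (auto intro!: inj_onI)

lemma (in ring) set_add_eq_image: "A <+>\<^bsub>R\<^esub> B = (\<lambda>(a, b). a \<oplus> b) ` (A \<times> B)"
  by (auto simp: set_add_def')

lemma (in ring) card_direct_sum:
  assumes "subgroup A (add_monoid R)" "subgroup B (add_monoid R)" "A \<inter> B = {\<zero>}"
  shows "card (A <+>\<^bsub>R\<^esub> B) = card A * card B"
  unfolding set_add_eq_image using inj_on_direct_sum[OF assms]
  by (simp add: card_image card_cartesian_product)

lemma (in ring) subspace_is_subgroup:
  assumes "subfield K R" "dimension n K E"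
  shows "subgroup E (add_monoid R)"
  using space_subgroup_props[OF assms] by (intro add.subgroupI) auto

text \<open>
  A subspace of dimension \<open>n + 1\<close> is the direct sum of a line \<open>K v\<close>, which has as many elements as \<open>K\<close>,
  and a subspace of dimension \<open>n\<close>. The sum is direct because a nonzero multiple of \<open>v\<close> in the
  smaller subspace would put \<open>v\<close> itself there.
\<close>

lemma (in field) card_subspace:
  assumes "subfield K R" "dimension n K E"
  shows "card E = card K ^ n"
  using assms(2)
proof (induction n arbitrary: E)
  case 0
  then show ?case using dimension_zero[OF assms(1) 0] by simp
next
  case (Suc n)
  then obtain v E' where v: "v \<in> carrier R" "v \<notin> E'" and dim: "dimension n K E'"
    and E: "E = line_extension K v E'"
    using dimension_backwards[OF assms(1) Suc.prems] by blast
  note E' = space_subgroup_props[OF assms(1) dim]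
  have K: "K \<subseteq> carrier R" using assms(1) subfieldE(3) by blast
  have "k \<otimes> v \<oplus> \<zero> = k \<otimes> v" if "k \<in> K" for k
    using that v(1) K by auto
  then have "K #> v = line_extension K v {\<zero>}"
    by (auto simp: line_extension_def set_add_def' r_coset_def)
  then have "dimension (Suc 0) K (K #> v)"
    using v E'(2) Suc_dim[OF v(1) _ zero_dim] by auto
  then have sub: "subgroup (K #> v) (add_monoid R)"
    using subspace_is_subgroup[OF assms(1)] by blast
  have trivial: "(K #> v) \<inter> E' = {\<zero>}"
  proof (intro equalityI subsetI)
    fix w assume w: "w \<in> (K #> v) \<inter> E'"
    then obtain k where k: "k \<in> K" "w = k \<otimes> v" by (auto simp: r_coset_def)
    then have "k = \<zero>" using E'(6)[of k v] v w by auto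
    then show "w \<in> {\<zero>}" using k v by simp
  next
    fix w assume "w \<in> {\<zero>}"
    then show "w \<in> (K #> v) \<inter> E'"
      using E'(2) add.subgroupE(1,2)[OF sub] subgroup.one_closed[OF sub] by auto
  qed
  have "v \<noteq> \<zero>" using v E'(2) by auto
  then have "inj_on (\<lambda>k. k \<otimes> v) K"
    using v K m_rcancel by (intro inj_onI) (meson subsetD)
  moreover have "K #> v = (\<lambda>k. k \<otimes> v) ` K" by (auto simp: r_coset_def)
  ultimately have "card (K #> v) = card K" by (simp add: card_image)
  then show ?case
    using card_direct_sum[OF sub subspace_is_subgroup[OF assms(1) dim] trivial] Suc.IH[OF dim] E
    by (simp add: line_extension_def)
qed

section \<open>Translating an affine point set along a subspace\<close>

definition vertical_translates ::
  "('a, 'b) ring_scheme \<Rightarrow> 'a set \<Rightarrow> ('a \<times> 'a) set \<Rightarrow> ('a \<times> 'a) set" where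
  "vertical_translates R I S = {(x, y \<oplus>\<^bsub>R\<^esub> i) | x y i. i \<in> I \<and> (x, y) \<in> S}"

locale translated_set = field R for R (structure) +
  fixes K I :: "'a set" and S :: "('a \<times> 'a) set" and s :: nat
  assumes finite_carrier: "finite (carrier R)"
    and subfield: "subfield K R"
    and dim: "dimension s K I"
    and trivial_Int: "I \<inter> K = {\<zero>}"
    and base_points: "S \<subseteq> K \<times> K"
begin

abbreviation T where "T \<equiv> vertical_translates R I S"
abbreviation V where "V \<equiv> K <+>\<^bsub>R\<^esub> I"

lemmas I_props = space_subgroup_props[OF subfield dim]

lemma K_subgroup: "subgroup K (add_monoid R)"
  using subring.axioms(1)[OF subfieldE(1)[OF subfield]] .

lemma I_subgroup: "subgroup I (add_monoid R)"
  using subspace_is_subgroup[OF subfield dim] .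

lemma carriers: "k \<in> K \<Longrightarrow> k \<in> carrier R" "i \<in> I \<Longrightarrow> i \<in> carrier R"
  using I_props(1) subfieldE(3)[OF subfield] by blast+

lemma base_points': "(x, y) \<in> S \<Longrightarrow> x \<in> K" "(x, y) \<in> S \<Longrightarrow> y \<in> K"
  using base_points by auto

lemma components_unique:
  assumes "k \<in> K" "k' \<in> K" "i \<in> I" "i' \<in> I" "k \<oplus> i = k' \<oplus> i'"
  shows "k = k'" "i = i'"
  using direct_sum_unique[OF K_subgroup I_subgroup] trivial_Int assms by blast+

lemma mem_V: "w \<in> V \<longleftrightarrow> (\<exists>k \<in> K. \<exists>i \<in> I. w = k \<oplus> i)"
  by (auto simp: set_add_def')

lemma V_carrier: "V \<subseteq> carrier R"
  using carriers by (auto simp: mem_V)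

lemma card_V: "card V = card K * card I"
  using card_direct_sum[OF K_subgroup I_subgroup] trivial_Int by blast

text \<open>
  Closure of \<open>V\<close> under differences and under multiplication by \<open>K\<close> is what forces the slope or the
  intercept of a line into \<open>V\<close> below.
\<close>

lemma V_diff:
  assumes "v \<in> V" "w \<in> V" shows "v \<ominus> w \<in> V"
proof -
  obtain k i k' i' where v: "k \<in> K" "i \<in> I" "v = k \<oplus> i" and w: "k' \<in> K" "i' \<in> I" "w = k' \<oplus> i'"
    using assms by (auto simp: mem_V)
  have "v \<ominus> w = (k \<ominus> k') \<oplus> (i \<ominus> i')"
    unfolding v(3) w(3) using v(1,2) w(1,2) carriers by algebra
  moreover have "k \<ominus> k' \<in> K" "i \<ominus> i' \<in> I"
    using v w K_subgroup I_subgroup add.subgroupE(3,4) by (simp_all add: a_minus_def)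
  ultimately show ?thesis by (auto simp: mem_V)
qed

lemma V_smult:
  assumes "k \<in> K" "v \<in> V" shows "k \<otimes> v \<in> V"
proof -
  obtain k' i where v: "k' \<in> K" "i \<in> I" "v = k' \<oplus> i"
    using assms by (auto simp: mem_V)
  have "k \<otimes> v = k \<otimes> k' \<oplus> k \<otimes> i"
    unfolding v(3) using v(1,2) assms(1) carriers by algebra
  moreover have "k \<otimes> k' \<in> K" "k \<otimes> i \<in> I"
    using v assms(1) subringE(6)[OF subfieldE(1)[OF subfield]] I_props(5) by auto
  ultimately show ?thesis by (auto simp: mem_V)
qed

lemma T_mem: "(x, w) \<in> T \<longleftrightarrow> (\<exists>y. \<exists>i \<in> I. (x, y) \<in> S \<and> w = y \<oplus> i)"
  by (auto simp: vertical_translates_def)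

text \<open>
  The two coordinates play different roles: differences of abscissas can be inverted within \<open>K\<close>, while
  ordinates only lie in a \<open>K\<close>-subspace.
\<close>

lemma T_in: "(x, w) \<in> T \<Longrightarrow> x \<in> K" "(x, w) \<in> T \<Longrightarrow> w \<in> V"
  using base_points' by (auto simp: T_mem mem_V)

lemma T_carrier: "T \<subseteq> carrier R \<times> carrier R"
  using T_in V_carrier carriers by auto

lemma T_eq_image: "T = (\<lambda>((x, y), i). (x, y \<oplus> i)) ` (S \<times> I)"
  unfolding vertical_translates_def by force

lemma inj_on_translate: "inj_on (\<lambda>((x, y), i). (x, y \<oplus> i)) (S \<times> I)"
proof (rule inj_onI, clarsimp)
  fix x y i y' i'
  assume a: "(x, y) \<in> S" "i \<in> I" "(x, y') \<in> S" "i' \<in> I" and e: "y \<oplus> i = y' \<oplus> i'"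
  show "y = y' \<and> i = i'"
    using components_unique[OF base_points'(2)[OF a(1)] base_points'(2)[OF a(3)] a(2,4) e] by simp
qed

lemma card_T: "card T = card I * card S"
  unfolding T_eq_image using inj_on_translate by (simp add: card_image card_cartesian_product)

lemma finite_K: "finite K"
  using finite_carrier carriers by (meson finite_subset subsetI)

lemma card_vertical_fibre:
  "card {p \<in> T. fst p = x} = card I * card {p \<in> S. fst p = x}"
proof -
  have "{p \<in> T. fst p = x} = (\<lambda>((x, y), i). (x, y \<oplus> i)) ` ({p \<in> S. fst p = x} \<times> I)"
    unfolding T_eq_image by force
  moreover have "inj_on (\<lambda>((x, y), i). (x, y \<oplus> i)) ({p \<in> S. fst p = x} \<times> I)"
    by (rule inj_on_subset[OF inj_on_translate]) auto
  ultimately show ?thesis by (simp add: card_image card_cartesian_product)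
qed

text \<open>
  For \<open>x\<close> in \<open>K\<close>, the value \<open>(d\<^sub>0 + d\<^sub>1) x + (b\<^sub>0 + b\<^sub>1)\<close> has component \<open>d\<^sub>0 x + b\<^sub>0\<close> in \<open>K\<close> and component
  \<open>d\<^sub>1 x + b\<^sub>1\<close> in \<open>I\<close>. So \<open>(x, y + i)\<close> lies on the line exactly when \<open>(x, y)\<close> lies on \<open>y = d\<^sub>0 x + b\<^sub>0\<close> and
  \<open>i\<close> is the translation that \<open>x\<close> prescribes: each point of \<open>S\<close> on the small line lifts to a unique point.
\<close>

lemma card_points_on_slope_V:
  assumes "d\<^sub>0 \<in> K" "d\<^sub>1 \<in> I" "b\<^sub>0 \<in> K" "b\<^sub>1 \<in> I"
  shows "card (points_on_slope R T (d\<^sub>0 \<oplus> d\<^sub>1) (b\<^sub>0 \<oplus> b\<^sub>1)) = card (points_on_slope R S d\<^sub>0 b\<^sub>0)"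
proof -
  \<comment> \<open>the translation that carries a point with abscissa \<open>x\<close> onto the lifted line\<close>
  define i where "i x = d\<^sub>1 \<otimes> x \<oplus> b\<^sub>1" for x
  have iI: "i x \<in> I" if "x \<in> K" for x
    using that assms I_props(3) I_props(5)[of x d\<^sub>1] m_comm[of x d\<^sub>1] carriers
    by (simp add: i_def)
  have line: "(d\<^sub>0 \<oplus> d\<^sub>1) \<otimes> x \<oplus> (b\<^sub>0 \<oplus> b\<^sub>1) = (d\<^sub>0 \<otimes> x \<oplus> b\<^sub>0) \<oplus> i x" if "x \<in> K" for x
    unfolding i_def using carriers(1)[OF that] assms carriers by algebra
  have K: "d\<^sub>0 \<otimes> x \<oplus> b\<^sub>0 \<in> K" if "x \<in> K" for x
    using that assms subringE(6,7)[OF subfieldE(1)[OF subfield]] by auto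
  have "points_on_slope R T (d\<^sub>0 \<oplus> d\<^sub>1) (b\<^sub>0 \<oplus> b\<^sub>1) =
      (\<lambda>(x, y). (x, y \<oplus> i x)) ` points_on_slope R S d\<^sub>0 b\<^sub>0"
  proof (intro equalityI subsetI)
    fix p assume "p \<in> points_on_slope R T (d\<^sub>0 \<oplus> d\<^sub>1) (b\<^sub>0 \<oplus> b\<^sub>1)"
    then obtain x y j where p: "p = (x, y \<oplus> j)" "j \<in> I" "(x, y) \<in> S"
      and e: "y \<oplus> j = (d\<^sub>0 \<oplus> d\<^sub>1) \<otimes> x \<oplus> (b\<^sub>0 \<oplus> b\<^sub>1)"
      by (auto simp: points_on_slope_def T_mem)
    note xy = base_points'[OF p(3)]
    have "y = d\<^sub>0 \<otimes> x \<oplus> b\<^sub>0" "j = i x"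
      using components_unique[OF xy(2) K[OF xy(1)] p(2) iI[OF xy(1)]] e line[OF xy(1)] by auto
    then show "p \<in> (\<lambda>(x, y). (x, y \<oplus> i x)) ` points_on_slope R S d\<^sub>0 b\<^sub>0"
      using p by (auto simp: points_on_slope_def)
  next
    fix p assume "p \<in> (\<lambda>(x, y). (x, y \<oplus> i x)) ` points_on_slope R S d\<^sub>0 b\<^sub>0"
    then obtain x y where p: "p = (x, y \<oplus> i x)" "(x, y) \<in> S" "y = d\<^sub>0 \<otimes> x \<oplus> b\<^sub>0"
      by (auto simp: points_on_slope_def)
    note xy = base_points'[OF p(2)]
    have "(x, y \<oplus> i x) \<in> T"
      using p(2) iI[OF xy(1)] unfolding T_mem by blast
    then show "p \<in> points_on_slope R T (d\<^sub>0 \<oplus> d\<^sub>1) (b\<^sub>0 \<oplus> b\<^sub>1)"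
      using p(1,3) line[OF xy(1)] by (simp add: points_on_slope_def)
  qed
  moreover have "inj_on (\<lambda>(x, y). (x, y \<oplus> i x)) (points_on_slope R S d\<^sub>0 b\<^sub>0)"
    by (auto intro!: inj_onI simp: points_on_slope_def)
  ultimately show ?thesis by (simp add: card_image)
qed

text \<open>A point \<open>(x, w)\<close> of \<open>T\<close> on the line would give \<open>b = w - x d\<close>, a combination of elements of \<open>V\<close>.\<close>

lemma points_on_slope_outside_V:
  assumes "d \<in> V" "b \<in> carrier R - V"
  shows "points_on_slope R T d b = {}"
proof (rule ccontr)
  assume "points_on_slope R T d b \<noteq> {}"
  then obtain x w where xw: "(x, w) \<in> T" "w = d \<otimes> x \<oplus> b"
    by (auto simp: points_on_slope_def)
  have car: "x \<in> carrier R" "d \<in> carrier R" "b \<in> carrier R"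
    using T_in(1)[OF xw(1)] carriers assms V_carrier by auto
  have "b = w \<ominus> x \<otimes> d"
    unfolding xw(2) using car by algebra
  then have "b \<in> V"
    using V_diff V_smult T_in[OF xw(1)] assms(1) by simp
  then show False using assms(2) by simp
qed

definition intercept where "intercept d = (\<lambda>(x, w). w \<ominus> d \<otimes> x)"

text \<open>
  Two points \<open>(x, w)\<close> and \<open>(x', w')\<close> with the same intercept satisfy \<open>w - w' = (x - x') d\<close>. If
  \<open>x \<noteq> x'\<close>, dividing by the element \<open>x - x'\<close> of \<open>K\<close> would put \<open>d\<close> into \<open>V\<close>. So every line with slope
  outside \<open>V\<close> carries at most one point of \<open>T\<close>.
\<close>

lemma inj_on_intercept:
  assumes "d \<in> carrier R - V"
  shows "inj_on (intercept d) T"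
proof (rule inj_onI, clarify)
  fix x w x' w'
  assume t: "(x, w) \<in> T" "(x', w') \<in> T" and eq: "intercept d (x, w) = intercept d (x', w')"
  have xK: "x \<in> K" "x' \<in> K" and wV: "w \<in> V" "w' \<in> V"
    using t T_in by auto
  have car: "x \<in> carrier R" "x' \<in> carrier R" "w \<in> carrier R" "w' \<in> carrier R" "d \<in> carrier R"
    using xK wV carriers V_carrier assms by auto
  have e: "w \<ominus> d \<otimes> x = w' \<ominus> d \<otimes> x'"
    using eq by (simp add: intercept_def)
  have "w \<ominus> w' = (w \<ominus> d \<otimes> x) \<oplus> d \<otimes> x \<ominus> w'" using car by algebra
  also have "\<dots> = (w' \<ominus> d \<otimes> x') \<oplus> d \<otimes> x \<ominus> w'" unfolding e ..
  also have "\<dots> = (x \<ominus> x') \<otimes> d" using car by algebra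
  finally have diff: "w \<ominus> w' = (x \<ominus> x') \<otimes> d" .
  have k: "x \<ominus> x' \<in> K"
    using xK K_subgroup add.subgroupE(3,4) by (simp add: a_minus_def)
  have same_x: "x \<ominus> x' = \<zero>"
  proof (rule ccontr)
    assume nz: "x \<ominus> x' \<noteq> \<zero>"
    let ?u = "inv (x \<ominus> x')"
    have u: "?u \<in> K"
      using subfield_m_inv(1)[OF subfield] k nz by auto
    have "d = ?u \<otimes> (w \<ominus> w')"
      unfolding diff using inv_nonzero[of "x \<ominus> x'"] nz car by (simp add: m_assoc[symmetric])
    then have "d \<in> V"
      using V_smult[OF u] V_diff wV by simp
    then show False using assms by simp
  qed
  have "w \<ominus> w' = \<zero>"
    unfolding diff same_x using car(5) by simp
  then show "x = x' \<and> w = w'"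
    using same_x car by simp
qed

lemma points_on_slope_eq_intercept:
  assumes "d \<in> carrier R" "b \<in> carrier R"
  shows "points_on_slope R T d b = {p \<in> T. intercept d p = b}"
proof -
  have "w = d \<otimes> x \<oplus> b \<longleftrightarrow> w \<ominus> d \<otimes> x = b" if "(x, w) \<in> T" for x w
  proof -
    have car: "x \<in> carrier R" "w \<in> carrier R"
      using that T_carrier by auto
    have "d \<otimes> x \<oplus> b \<ominus> d \<otimes> x = b" "(w \<ominus> d \<otimes> x) \<oplus> d \<otimes> x = w"
      using car assms by algebra+
    then show ?thesis using a_comm car assms by (metis m_closed)
  qed
  then show ?thesis
    unfolding points_on_slope_def intercept_def by auto
qed

lemma card_points_on_slope_direction_outside_V:
  assumes "d \<in> carrier R - V" "b \<in> carrier R"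
  shows "card (points_on_slope R T d b) = (if b \<in> intercept d ` T then 1 else 0)"
proof (cases "b \<in> intercept d ` T")
  case True
  then obtain p where p: "p \<in> T" "b = intercept d p" by blast
  have "points_on_slope R T d b = {p}"
    using points_on_slope_eq_intercept assms p inj_on_intercept[OF assms(1)]
    by (auto dest: inj_onD)
  then show ?thesis using True by simp
next
  case False
  then have "points_on_slope R T d b = {}"
    using points_on_slope_eq_intercept assms by auto
  then show ?thesis using False by simp
qed

lemma card_points_on_slope_cases:
  assumes "d \<in> carrier R" "b \<in> carrier R"
  shows "card (points_on_slope R T d b) = 0 \<or> card (points_on_slope R T d b) = 1 \<or>
    (\<exists>d\<^sub>0 \<in> K. \<exists>b\<^sub>0 \<in> K. card (points_on_slope R T d b) = card (points_on_slope R S d\<^sub>0 b\<^sub>0))"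
proof (cases "d \<in> V")
  case True
  show ?thesis
  proof (cases "b \<in> V")
    case b: True
    then show ?thesis
      using True card_points_on_slope_V unfolding mem_V by blast
  next
    case False
    then show ?thesis
      using points_on_slope_outside_V[OF True, of b] assms by simp
  qed
next
  case False
  then show ?thesis
    using card_points_on_slope_direction_outside_V[of d b] assms by simp
qed

lemma secants_of_direction_outside_V:
  assumes "d \<in> carrier R - V"
  shows "card (affine_secants_through R (aff_point R ` T) 1 (direction R d)) = card T"
    and "card (affine_secants_through R (aff_point R ` T) 0 (direction R d)) + card T =
      card (carrier R)"
proof -
  have d: "d \<in> carrier R" using assms by simp
  have sub: "intercept d ` T \<subseteq> carrier R"
    using T_carrier d by (auto simp: intercept_def)
  have "{b \<in> carrier R. card (points_on_slope R T d b) = 1} = intercept d ` T"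
    "{b \<in> carrier R. card (points_on_slope R T d b) = 0} = carrier R - intercept d ` T"
    using card_points_on_slope_direction_outside_V[OF assms] sub by (auto split: if_splits)
  moreover have "card (intercept d ` T) = card T"
    by (rule card_image[OF inj_on_intercept[OF assms]])
  moreover have "card (carrier R - intercept d ` T) + card (intercept d ` T) = card (carrier R)"
    using card_Diff_subset[OF finite_subset[OF sub finite_carrier] sub]
      card_mono[OF finite_carrier sub] by simp
  ultimately show "card (affine_secants_through R (aff_point R ` T) 1 (direction R d)) = card T"
    "card (affine_secants_through R (aff_point R ` T) 0 (direction R d)) + card T = card (carrier R)"
    by (simp_all add: card_affine_secants_through_direction[OF d T_carrier])
qed

text \<open>
  Lines of slope \<open>d\<^sub>0 + d\<^sub>1\<close> are sorted by their intercept. Those with intercept outside \<open>V\<close> form \<open>N\<close>, and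
  those with intercept \<open>b\<^sub>0 + b\<^sub>1\<close> meet \<open>T\<close> as often as \<open>y = d\<^sub>0 x + b\<^sub>0\<close> meets \<open>S\<close>. So \<open>M i\<close> consists
  of the lines with \<open>b\<^sub>0\<close> in \<open>B i\<close>, and the free choice of \<open>b\<^sub>1\<close> accounts for the factor \<open>card I\<close>. The
  sets \<open>B i\<close> partition \<open>K\<close>; they are disjoint because the entries of \<open>ns\<close> are distinct.
\<close>

lemma secants_of_direction_in_V:
  fixes ns :: "nat list"
  assumes "d\<^sub>0 \<in> K" "d\<^sub>1 \<in> I" and "distinct ns"
    and type: "\<And>b. b \<in> K \<Longrightarrow> \<exists>i < length ns. card (points_on_slope R S d\<^sub>0 b) = ns ! i"
  defines "B \<equiv> \<lambda>i. {b \<in> K. card (points_on_slope R S d\<^sub>0 b) = ns ! i}"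
    and "P \<equiv> direction R (d\<^sub>0 \<oplus> d\<^sub>1)"
  obtains N M where "{l \<in> affine_lines R. P \<in> l} = N \<union> (\<Union>i < length ns. M i)"
    and "disjoint_family_on M {..<length ns}"
    and "N \<inter> (\<Union>i < length ns. M i) = {}"
    and "card N + card V = card (carrier R)"
    and "\<And>l. l \<in> N \<Longrightarrow> card (l \<inter> aff_point R ` T) = 0"
    and "\<And>i. i < length ns \<Longrightarrow> card (M i) = card (B i) * card I"
    and "\<And>i l. i < length ns \<Longrightarrow> l \<in> M i \<Longrightarrow> card (l \<inter> aff_point R ` T) = ns ! i"
    and "(\<Sum>i < length ns. card (B i)) = card K"
proof -
  let ?d = "d\<^sub>0 \<oplus> d\<^sub>1"
  let ?line = "slope_line R ?d"
  \<comment> \<open>the intercepts of the lines in the class \<open>M i\<close>\<close>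
  let ?C = "\<lambda>i. (\<lambda>(b, c). b \<oplus> c) ` (B i \<times> I)"
  have dV: "?d \<in> V" using assms(1,2) by (auto simp: mem_V)
  then have d: "?d \<in> carrier R" using V_carrier by blast
  have B_Un: "(\<Union>i < length ns. B i) = K"
    using type by (fastforce simp: B_def)
  have B_disj: "i = j" if "i < length ns" "j < length ns" "b \<in> B i" "b \<in> B j" for i j b
    using that \<open>distinct ns\<close> by (auto simp: B_def nth_eq_iff_index_eq)
  have BK: "B i \<subseteq> K" for i by (auto simp: B_def)
  have C_Un: "(\<Union>i < length ns. ?C i) = V"
    unfolding set_add_eq_image B_Un[symmetric] by blast
  have C_disj: "i = j" if ij: "i < length ns" "j < length ns" and e: "e \<in> ?C i" "e \<in> ?C j" for i j e
  proof -
    obtain b c b' c' where bc: "b \<in> B i" "c \<in> I" "b' \<in> B j" "c' \<in> I" "b \<oplus> c = b' \<oplus> c'"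
      using e by auto
    then have "b = b'" using components_unique(1)[of b b' c c'] BK by blast
    then show ?thesis using B_disj ij bc by blast
  qed
  have C_carrier: "?C i \<subseteq> carrier R" for i
    using BK[of i] carriers by auto
  have inj: "inj_on ?line (carrier R)" by (rule inj_on_slope_line[OF d])
  show thesis
  proof (rule that[of "?line ` (carrier R - V)" "\<lambda>i. ?line ` ?C i"])
    show "{l \<in> affine_lines R. P \<in> l} = ?line ` (carrier R - V) \<union> (\<Union>i < length ns. ?line ` ?C i)"
    proof -
      have "carrier R = (carrier R - V) \<union> (\<Union>i < length ns. ?C i)"
        using C_Un V_carrier by blast
      then show ?thesis
        unfolding P_def affine_lines_through_direction[OF d] by (metis image_UN image_Un)
    qed
    show "disjoint_family_on (\<lambda>i. ?line ` ?C i) {..<length ns}"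
      unfolding disjoint_family_on_def
    proof (intro ballI impI)
      fix i j assume ij: "i \<in> {..<length ns}" "j \<in> {..<length ns}" "i \<noteq> j"
      have "?C i \<inter> ?C j = {}" using C_disj[of i j] ij by blast
      then show "?line ` ?C i \<inter> ?line ` ?C j = {}"
        using inj_on_image_Int[OF inj C_carrier[of i] C_carrier[of j]] by (metis image_empty)
    qed
    show "?line ` (carrier R - V) \<inter> (\<Union>i < length ns. ?line ` ?C i) = {}"
    proof -
      have "?line ` (carrier R - V) \<inter> ?line ` V = {}"
        using inj_on_image_Int[OF inj _ V_carrier, of "carrier R - V"] by auto
      then show ?thesis by (metis C_Un image_UN)
    qed
    have "card (?line ` (carrier R - V)) = card (carrier R - V)"
      by (rule card_image[OF inj_on_subset[OF inj]]) blast
    then show "card (?line ` (carrier R - V)) + card V = card (carrier R)"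
      using card_Diff_subset[OF finite_subset[OF V_carrier finite_carrier] V_carrier]
        card_mono[OF finite_carrier V_carrier] by simp
    show "card (l \<inter> aff_point R ` T) = 0" if "l \<in> ?line ` (carrier R - V)" for l
      using that card_slope_line_Int[OF d _ T_carrier] points_on_slope_outside_V[OF dV] by auto
    show "card (?line ` ?C i) = card (B i) * card I" if "i < length ns" for i
    proof -
      have "inj_on (\<lambda>(b, c). b \<oplus> c) (B i \<times> I)"
        using inj_on_direct_sum[OF K_subgroup I_subgroup] trivial_Int BK[of i]
        by (auto intro: inj_on_subset)
      then show ?thesis
        using card_image[OF inj_on_subset[OF inj C_carrier[of i]]]
        by (simp add: card_image card_cartesian_product)
    qed
    show "card (l \<inter> aff_point R ` T) = ns ! i" if i: "i < length ns" and l: "l \<in> ?line ` ?C i" for i l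
    proof -
      obtain b c where bc: "b \<in> B i" "c \<in> I" "l = ?line (b \<oplus> c)" using l by auto
      then have "b \<in> K" using BK by blast
      then show ?thesis
        using bc card_slope_line_Int[OF d _ T_carrier, of "b \<oplus> c"] carriers
          card_points_on_slope_V[OF assms(1,2), of b c] by (simp add: B_def)
    qed
    have "card (\<Union>i < length ns. B i) = (\<Sum>i < length ns. card (B i))"
      using B_disj finite_subset[OF BK finite_K] by (intro card_UN_disjoint) blast+
    then show "(\<Sum>i < length ns. card (B i)) = card K" using B_Un by simp
  qed
qed

end

section \<open>The lines of the extended plane and the translated set\<close>

theorem theorem2p2:
  fixes L F :: "('a, 'b) ring_scheme"
    and K I :: "'a set"
    and S S' :: "('a \<times> 'a) set"
    and X X' :: "('a \<times> 'a \<times> 'a) set set"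
    and D :: "('a \<times> 'a \<times> 'a) set set"
    and q h s :: nat
    and m :: "nat list"
    and v :: "int list"
  assumes "primepow q" and "h > 0"
    and "field L" and "finite (carrier L)" and "order L = q ^ h"
    and "subfield K L" and "card K = q"
    and F_def: "F = L\<lparr>carrier := K\<rparr>"
    and "S \<subseteq> K \<times> K"
    and X_def: "X = aff_point F ` S"
    and "affine_type F (X \<union> {pt_inf F}) m" and "distinct m"
    and "\<forall>l \<in> vertical_lines F. \<exists>i < length v. int (card (l \<inter> X)) = v ! i"
    and "ring.dimension L s K I" and "I \<noteq> {\<zero>\<^bsub>L\<^esub>}" and "I \<inter> K = {\<zero>\<^bsub>L\<^esub>}"
    and S'_def: "S' = {(x, y \<oplus>\<^bsub>L\<^esub> i) | x y i. i \<in> I \<and> (x, y) \<in> S}"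
    and X'_def: "X' = aff_point L ` S'"
    and D_def: "D = direction L ` (K <+>\<^bsub>L\<^esub> I)"
  shows "
    (S' \<subseteq> carrier L \<times> carrier L \<and> card S' = q ^ s * card S) \<and>
    (\<forall>l \<in> vertical_lines L.
       card (l \<inter> X') = 0 \<or> (\<exists>i < length v. int (card (l \<inter> X')) = int (q ^ s) * v ! i)) \<and>
    (\<forall>l \<in> affine_lines L - vertical_lines L.
       card (l \<inter> X') = 0 \<or> card (l \<inter> X') = 1 \<or> (\<exists>i < length m. card (l \<inter> X') = m ! i)) \<and>
    (affine_type L (X' \<union> {pt_inf L}) (0 # 1 # m)) \<and>
    (D \<subseteq> line_inf L - {pt_inf L} \<and> card D = q ^ (s + 1)) \<and>
    (\<forall>d\<^sub>0 \<in> K. \<forall>d\<^sub>1 \<in> I.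
       let P = direction L (d\<^sub>0 \<oplus>\<^bsub>L\<^esub> d\<^sub>1);
           A = (\<lambda>i. card (affine_secants_through F X (m ! i) (direction F d\<^sub>0)))
       in card {l \<in> affine_lines L. P \<in> l} = q ^ h \<and>
          (\<exists>N M. {l \<in> affine_lines L. P \<in> l} = N \<union> (\<Union>i < length m. M i) \<and>
             disjoint_family_on M {..<length m} \<and> N \<inter> (\<Union>i < length m. M i) = {} \<and>
             int (card N) = int (q ^ h) - int (q ^ (s + 1)) \<and> (\<forall>l \<in> N. card (l \<inter> X') = 0) \<and>
             (\<forall>i < length m. card (M i) = A i * q ^ s \<and> (\<forall>l \<in> M i. card (l \<inter> X') = m ! i))) \<and>
          (\<Sum>i < length m. A i) = q) \<and>
    (int (card (line_inf L - {pt_inf L} - D)) = int (q ^ h) - int (q ^ (s + 1))) \<and>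
    (\<forall>P \<in> line_inf L - {pt_inf L} - D.
       card (affine_secants_through L X' 1 P) = q ^ s * card S \<and>
       int (card (affine_secants_through L X' 0 P)) = int (q ^ h) - int (q ^ s * card S))"
(is "?size \<and> ?vert \<and> ?nonvert \<and> ?type \<and> ?D \<and> ?in_D \<and> ?card_out \<and> ?out_D")
proof -
  note q = \<open>card K = q\<close>
  interpret field L by fact
  interpret translated_set L K I S s
    by (intro translated_set.intro translated_set_axioms.intro) fact+
  interpret F: field F
    unfolding F_def using subfield_iff(2)[OF subfield] .
  have F_car: "carrier F = K" by (simp add: F_def)
  have S_L: "S \<subseteq> carrier L \<times> carrier L" and S_F: "S \<subseteq> carrier F \<times> carrier F"
    using base_points carriers by (auto simp: F_car)
  have S': "S' = T" by (simp add: S'_def vertical_translates_def)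
  have X': "X' = aff_point L ` T" by (simp add: X'_def S')
  have D: "D = direction L ` V" by (simp add: D_def)
  have card_I: "card I = q ^ s" using card_subspace[OF subfield dim] q by simp
  have card_VL: "card V = q ^ (s + 1)" using card_V card_I q by simp
  have card_L: "card (carrier L) = q ^ h" using assms by (simp add: order_def)
  have slope_F: "points_on_slope F S d b = points_on_slope L S d b" for d b
    by (simp add: points_on_slope_def F_def)
  have type_S: "\<exists>i < length m. card (points_on_slope L S d b) = m ! i" if "d \<in> K" "b \<in> K" for d b
    using \<open>affine_type F (X \<union> {pt_inf F}) m\<close> that
    unfolding X_def F.affine_type_iff[OF S_F] F_car slope_F by blast
  have vert_S: "\<exists>i < length v. int (card {p \<in> S. fst p = \<alpha>}) = v ! i" if "\<alpha> \<in> K" for \<alpha>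
  proof -
    have "vertical_line F \<alpha> \<in> vertical_lines F"
      using that by (simp add: F.vertical_lines_eq F_car)
    then have "\<exists>i < length v. int (card (vertical_line F \<alpha> \<inter> X)) = v ! i"
      using assms(13) by blast
    then show ?thesis
      using F.card_vertical_line_Int[OF _ S_F, of \<alpha>] that by (simp add: X_def F_car)
  qed
  have slope_T: "card (points_on_slope L T d b) = 0 \<or> card (points_on_slope L T d b) = 1 \<or>
      (\<exists>i < length m. card (points_on_slope L T d b) = m ! i)"
    if "d \<in> carrier L" "b \<in> carrier L" for d b
    using card_points_on_slope_cases[OF that] type_S by metis
  have out: "line_inf L - {pt_inf L} - D = direction L ` (carrier L - V)"
    unfolding D line_inf_eq
    using inj_on_image_set_diff[OF inj_on_direction _ V_carrier, of "carrier L"] by simp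

  have ?size
    using T_carrier card_T card_I by (simp add: S')
  moreover have ?vert
  proof
    fix l assume "l \<in> vertical_lines L"
    then obtain \<alpha> where \<alpha>: "\<alpha> \<in> carrier L" and l: "l = vertical_line L \<alpha>"
      by (auto simp: vertical_lines_eq)
    have card: "card (l \<inter> X') = q ^ s * card {p \<in> S. fst p = \<alpha>}"
      using card_vertical_line_Int[OF \<alpha> T_carrier] card_vertical_fibre card_I
      by (simp add: X' l)
    show "card (l \<inter> X') = 0 \<or> (\<exists>i < length v. int (card (l \<inter> X')) = int (q ^ s) * v ! i)"
    proof (cases "\<alpha> \<in> K")
      case True
      then show ?thesis using vert_S[OF True] unfolding card of_nat_mult by metis
    next
      case False
      then have "{p \<in> S. fst p = \<alpha>} = {}" using base_points by auto
      then have "card (l \<inter> X') = 0" unfolding card by (metis card.empty mult_0_right)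
      then show ?thesis ..
    qed
  qed
  moreover have ?nonvert
  proof
    fix l assume "l \<in> affine_lines L - vertical_lines L"
    then obtain d b where "d \<in> carrier L" "b \<in> carrier L" "l = slope_line L d b"
      by (auto simp: affine_lines_eq)
    then show "card (l \<inter> X') = 0 \<or> card (l \<inter> X') = 1 \<or> (\<exists>i < length m. card (l \<inter> X') = m ! i)"
      using slope_T[of d b] card_slope_line_Int[OF _ _ T_carrier, of d b] by (simp add: X')
  qed
  moreover have ?type
    unfolding X' affine_type_iff[OF T_carrier]
  proof (intro ballI)
    fix d b assume db: "d \<in> carrier L" "b \<in> carrier L"
    let ?c = "card (points_on_slope L T d b)"
    have "?c \<in> set (0 # 1 # m)"
      using slope_T[OF db] by (auto simp: in_set_conv_nth)
    then show "\<exists>i < length (0 # 1 # m). ?c = (0 # 1 # m) ! i"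
      by (metis in_set_conv_nth)
  qed
  moreover have ?D
  proof
    show "D \<subseteq> line_inf L - {pt_inf L}"
      unfolding D line_inf_eq using V_carrier by blast
    show "card D = q ^ (s + 1)"
      unfolding D using card_image[OF inj_on_subset[OF inj_on_direction V_carrier]] card_VL by simp
  qed
  moreover have ?in_D
  proof (intro ballI)
    fix d\<^sub>0 d\<^sub>1 assume d: "d\<^sub>0 \<in> K" "d\<^sub>1 \<in> I"
    have dc: "d\<^sub>0 \<oplus>\<^bsub>L\<^esub> d\<^sub>1 \<in> carrier L" using d carriers by simp
    have A: "card (affine_secants_through F X k (direction F d\<^sub>0)) =
        card {b \<in> K. card (points_on_slope L S d\<^sub>0 b) = k}" for k
      using F.card_affine_secants_through_direction[OF _ S_F, of d\<^sub>0] d(1)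
      by (simp add: X_def F_car slope_F)
    have all: "card {l \<in> affine_lines L. direction L (d\<^sub>0 \<oplus>\<^bsub>L\<^esub> d\<^sub>1) \<in> l} = q ^ h"
      unfolding affine_lines_through_direction[OF dc] card_image[OF inj_on_slope_line[OF dc]]
      by (rule card_L)
    obtain N M where NM:
      "{l \<in> affine_lines L. direction L (d\<^sub>0 \<oplus>\<^bsub>L\<^esub> d\<^sub>1) \<in> l} = N \<union> (\<Union>i < length m. M i)"
      "disjoint_family_on M {..<length m}" "N \<inter> (\<Union>i < length m. M i) = {}"
      "card N + card V = card (carrier L)" "\<And>l. l \<in> N \<Longrightarrow> card (l \<inter> aff_point L ` T) = 0"
      "\<And>i. i < length m \<Longrightarrow>
        card (M i) = card {b \<in> K. card (points_on_slope L S d\<^sub>0 b) = m ! i} * card I"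
      "\<And>i l. i < length m \<Longrightarrow> l \<in> M i \<Longrightarrow> card (l \<inter> aff_point L ` T) = m ! i"
      "(\<Sum>i < length m. card {b \<in> K. card (points_on_slope L S d\<^sub>0 b) = m ! i}) = card K"
      using secants_of_direction_in_V[OF d \<open>distinct m\<close> type_S[OF d(1)]] by blast
    have "int (card N) = int (q ^ h) - int (q ^ (s + 1))"
      using NM(4) card_VL card_L by linarith
    then show "let P = direction L (d\<^sub>0 \<oplus>\<^bsub>L\<^esub> d\<^sub>1);
           A = (\<lambda>i. card (affine_secants_through F X (m ! i) (direction F d\<^sub>0)))
       in card {l \<in> affine_lines L. P \<in> l} = q ^ h \<and>
          (\<exists>N M. {l \<in> affine_lines L. P \<in> l} = N \<union> (\<Union>i < length m. M i) \<and>
             disjoint_family_on M {..<length m} \<and> N \<inter> (\<Union>i < length m. M i) = {} \<and>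
             int (card N) = int (q ^ h) - int (q ^ (s + 1)) \<and> (\<forall>l \<in> N. card (l \<inter> X') = 0) \<and>
             (\<forall>i < length m. card (M i) = A i * q ^ s \<and> (\<forall>l \<in> M i. card (l \<inter> X') = m ! i))) \<and>
          (\<Sum>i < length m. A i) = q"
      unfolding Let_def A X'
      using all NM(1-3) NM(5) NM(6)[unfolded card_I] NM(7) NM(8)[unfolded q]
      by (intro conjI exI[of _ N] exI[of _ M] allI ballI impI)
  qed
  moreover have ?card_out
  proof -
    have "card (direction L ` (carrier L - V)) = card (carrier L - V)"
      by (rule card_image[OF inj_on_subset[OF inj_on_direction]]) blast
    moreover have "card (carrier L - V) + card V = card (carrier L)"
      using card_Diff_subset[OF finite_subset[OF V_carrier finite_carrier] V_carrier]
        card_mono[OF finite_carrier V_carrier] by simp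
    ultimately show ?thesis unfolding out card_VL card_L by linarith
  qed
  moreover have ?out_D
    unfolding out
  proof (rule ballI, elim imageE)
    fix P d assume P: "P = direction L d" and d: "d \<in> carrier L - V"
    show "card (affine_secants_through L X' 1 P) = q ^ s * card S \<and>
       int (card (affine_secants_through L X' 0 P)) = int (q ^ h) - int (q ^ s * card S)"
      using secants_of_direction_outside_V[OF d] unfolding P X' card_T card_I card_L by linarith
  qed
  ultimately show ?thesis by - (assumption | rule conjI)+
qed

end
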